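(* There is an algorithm which, given any positive rational number $r$, decides in finitely many steps whether or not $r$ belongs to the Wooley semigroup $\mathcal{W}_0$, and, if it does, outputs an explicit representation of $r$ as a finite product of generators $g(n)=\frac{3n+2}{2n+1}$ (with repetitions allowed).
   Context: For integers $n\ge 0$ let $g(n)=\frac{3n+2}{2n+1}$. The Wooley semigroup $\mathcal{W}_0$ is the multiplicative semigroup generated by $\{g(n): n\ge 0\}=\{\frac{2}{1},\frac{5}{3},\frac{8}{5},\frac{11}{7},\dots\}$, i.e. the set of all finite (nonempty) products of these generators, repetitions allowed. *)

theory Defs
  imports Complex_Main "HOL-Library.Nat_Bijection"
begin

subsection \<open>The Wooley semigroup\<close>

definition wooley_gen :: "nat \<Rightarrow> rat" where
  "wooley_gen n = (3 * of_nat n + 2) / (2 * of_nat n + 1)"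

inductive_set semigroup_generated :: "'a::semigroup_mult set \<Rightarrow> 'a set" for G where
  base: "x \<in> G \<Longrightarrow> x \<in> semigroup_generated G"
| mult: "x \<in> semigroup_generated G \<Longrightarrow> y \<in> semigroup_generated G \<Longrightarrow>
    x * y \<in> semigroup_generated G"

definition wooley_semigroup :: "rat set" where
  "wooley_semigroup = semigroup_generated (range wooley_gen)"

lemma wooley_semigroup_eq_products:
  "wooley_semigroup = {prod_list (map wooley_gen ns) | ns. ns \<noteq> []}"
proof (intro equalityI subsetI)
  fix x assume "x \<in> wooley_semigroup"
  then have "x \<in> semigroup_generated (range wooley_gen)"
    by (simp add: wooley_semigroup_def)
  then have "\<exists>ns. x = prod_list (map wooley_gen ns) \<and> ns \<noteq> []"
  proof induction
    case (base x)
    then obtain n where "x = wooley_gen n" by blast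
    then have "x = prod_list (map wooley_gen [n]) \<and> [n] \<noteq> []" by simp
    then show ?case by blast
  next
    case (mult x y)
    then obtain ms ns where "x = prod_list (map wooley_gen ms)" "ms \<noteq> []"
      "y = prod_list (map wooley_gen ns)" by blast
    then have "x * y = prod_list (map wooley_gen (ms @ ns)) \<and> ms @ ns \<noteq> []" by simp
    then show ?case by blast
  qed
  then show "x \<in> {prod_list (map wooley_gen ns) | ns. ns \<noteq> []}" by blast
next
  fix x assume "x \<in> {prod_list (map wooley_gen ns) | ns. ns \<noteq> []}"
  then obtain ns where "x = prod_list (map wooley_gen ns)" "ns \<noteq> []" by blast
  moreover have "prod_list (map wooley_gen ns) \<in> semigroup_generated (range wooley_gen)"
    if "ns \<noteq> []" for ns
    using that by (induction ns rule: list_nonempty_induct)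
      (auto intro: semigroup_generated.intros)
  ultimately show "x \<in> wooley_semigroup" by (simp add: wooley_semigroup_def)
qed

subsection \<open>Algorithms\<close>

text \<open>
  The model of computation is that of Kleene's \<open>\<mu>\<close>-recursive functions: programs are terms built
  from the basic functions by composition, primitive recursion and unbounded minimisation.
  The relation \<open>computes p xs y\<close> says that \<open>p\<close>, run on the arguments \<open>xs\<close>, halts with result \<open>y\<close>;
  divergence is the absence of such a \<open>y\<close>. Programs carry no arity: \<open>Zero\<close> is the zero
  function of every arity and \<open>Proj i\<close> the projection to argument \<open>i\<close> (counted from 0) of every
  arity above \<open>i\<close>. Recursion and minimisation act on the first argument.
\<close>

datatype program =
    Zero
  | Succ
  | Proj nat
  | Comp program "program list"
  | PrimRec program program
  | Mini program

inductive computes :: "program \<Rightarrow> nat list \<Rightarrow> nat \<Rightarrow> bool" where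
  zero: "computes Zero xs 0"
| succ: "computes Succ [x] (Suc x)"
| proj: "i < length xs \<Longrightarrow> computes (Proj i) xs (xs ! i)"
| comp: "list_all2 (\<lambda>q y. computes q xs y) qs ys \<Longrightarrow> computes p ys z \<Longrightarrow>
    computes (Comp p qs) xs z"
| primrec_0: "computes p xs y \<Longrightarrow> computes (PrimRec p q) (0 # xs) y"
| primrec_Suc: "computes (PrimRec p q) (n # xs) y \<Longrightarrow> computes q (n # y # xs) z \<Longrightarrow>
    computes (PrimRec p q) (Suc n # xs) z"
| mini: "computes p (n # xs) 0 \<Longrightarrow> (\<forall>i<n. \<exists>y. computes p (i # xs) (Suc y)) \<Longrightarrow>
    computes (Mini p) xs n"

inductive_cases computes_ZeroE: "computes Zero xs y"
inductive_cases computes_SuccE: "computes Succ xs y"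
inductive_cases computes_ProjE: "computes (Proj i) xs y"
inductive_cases computes_CompE: "computes (Comp p qs) xs y"
inductive_cases computes_PrimRec_0E: "computes (PrimRec p q) (0 # xs) y"
inductive_cases computes_PrimRec_SucE: "computes (PrimRec p q) (Suc n # xs) y"
inductive_cases computes_MiniE: "computes (Mini p) xs y"

lemma computes_deterministic:
  "computes p xs y \<Longrightarrow> computes p xs y' \<Longrightarrow> y = y'"
proof (induction arbitrary: y' rule: computes.induct)
  case (zero xs)
  then show ?case by (rule computes_ZeroE) simp
next
  case (succ x)
  then show ?case by (rule computes_SuccE) simp
next
  case (proj i xs)
  from proj.prems show ?case by (rule computes_ProjE) simp
next
  case (comp xs qs ys p z)
  from comp.prems obtain ys' where ys':
    "list_all2 (\<lambda>q y. computes q xs y) qs ys'" "computes p ys' y'"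
    by (rule computes_CompE)
  have "ys = ys'"
  proof (rule nth_equalityI)
    show len: "length ys = length ys'"
      using list_all2_lengthD[OF comp.IH(1)] list_all2_lengthD[OF ys'(1)] by simp
    fix i assume "i < length ys"
    then show "ys ! i = ys' ! i"
      using list_all2_nthD2[OF comp.IH(1)] list_all2_nthD2[OF ys'(1)] len by metis
  qed
  with ys'(2) comp.IH(2) show ?case by simp
next
  case (primrec_0 p xs y q)
  from primrec_0.prems have "computes p xs y'" by (rule computes_PrimRec_0E)
  then show ?case by (rule primrec_0.IH)
next
  case (primrec_Suc p q n xs y z)
  from primrec_Suc.prems obtain w where "computes (PrimRec p q) (n # xs) w"
    "computes q (n # w # xs) y'"
    by (rule computes_PrimRec_SucE)
  with primrec_Suc.IH show ?case by metis
next
  case (mini p n xs)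
  from mini.prems obtain n': "computes p (y' # xs) 0" "\<forall>i<y'. \<exists>y. computes p (i # xs) (Suc y)"
    by (rule computes_MiniE)
  show ?case
  proof (rule linorder_cases[of n y'])
    assume "n < y'"
    then obtain y where "computes p (n # xs) (Suc y)" using n'(2) by blast
    from mini.IH(1)[OF this] show ?thesis by simp
  next
    assume "y' < n"
    then obtain y where "\<forall>z. computes p (y' # xs) z \<longrightarrow> Suc y = z" using mini.IH(2) by blast
    with n'(1) show ?thesis by auto
  qed
qed

text \<open>A positive rational is presented by its numerator and denominator in lowest terms.\<close>

definition rat_input :: "rat \<Rightarrow> nat list" where
  "rat_input r = [nat (fst (quotient_of r)), nat (snd (quotient_of r))]"

text \<open>
  \<open>None\<close> stands for a negative answer; \<open>Some ns\<close> for a positive answer together with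
  the list of indices of the generators in a product representation.
\<close>

fun answer_encode :: "nat list option \<Rightarrow> nat" where
  "answer_encode None = 0"
| "answer_encode (Some ns) = Suc (list_encode ns)"

lemma inj_answer_encode: "inj answer_encode"
proof (rule injI)
  fix a b assume "answer_encode a = answer_encode b"
  then show "a = b" by (cases a; cases b) (simp_all add: list_encode_eq)
qed

end

theory Submission
  imports Defs "HOL-Library.Multiset"
begin

text \<open>
  Write \<open>r = a / b\<close>. Since every generator exceeds \<open>3/2\<close>, the number \<open>k\<close> of factors is bounded.
  For fixed \<open>k\<close> the strict inequality \<open>a * 2 ^ k > b * 3 ^ k\<close> between integers leaves a gap which
  the smallest index \<open>n\<close> of a representation has to fill, and this forces \<open>n \<le> 6 ^ k * b\<close>.
  Dividing by \<open>g(n)\<close> replaces \<open>a / b\<close> by \<open>a (2n+1) / b (3n+2)\<close>, so all indices are bounded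
  in turn. Membership is thus decided by a search through the codes of index lists below a
  primitive recursive bound.
\<close>

section \<open>Closure properties of total recursive functions\<close>

text \<open>The arity \<open>k\<close> enters only as a length condition, so functions are maps on
  whole argument lists. One program has to halt on all lists of that length, which builds in
  totality.\<close>

definition computable :: "nat \<Rightarrow> (nat list \<Rightarrow> nat) \<Rightarrow> bool" where
  "computable k f \<longleftrightarrow> (\<exists>p. \<forall>xs. length xs = k \<longrightarrow> computes p xs (f xs))"

abbreviation decidable :: "nat \<Rightarrow> (nat list \<Rightarrow> bool) \<Rightarrow> bool" where
  "decidable k P \<equiv> computable k (\<lambda>xs. of_bool (P xs))"

lemma computable_cong:
  assumes "computable k f" "\<And>xs. length xs = k \<Longrightarrow> f xs = g xs"
  shows "computable k g"
  using assms unfolding computable_def by metis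

lemma computable_zero: "computable k (\<lambda>xs. 0)"
  unfolding computable_def by (blast intro: computes.zero)

lemma computable_nth: "i < k \<Longrightarrow> computable k (\<lambda>xs. xs ! i)"
  unfolding computable_def by (blast intro: computes.proj)

lemma computable_comp:
  assumes f: "computable (length gs) f" and gs: "\<And>g. g \<in> set gs \<Longrightarrow> computable k g"
  shows "computable k (\<lambda>xs. f (map (\<lambda>g. g xs) gs))"
proof -
  obtain p where p: "\<And>ys. length ys = length gs \<Longrightarrow> computes p ys (f ys)"
    using f unfolding computable_def by blast
  obtain q where q: "\<And>g xs. g \<in> set gs \<Longrightarrow> length xs = k \<Longrightarrow> computes (q g) xs (g xs)"
    using gs unfolding computable_def by metis
  have "computes (Comp p (map q gs)) xs (f (map (\<lambda>g. g xs) gs))" if "length xs = k" for xs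
  proof (rule computes.comp)
    show "list_all2 (\<lambda>q y. computes q xs y) (map q gs) (map (\<lambda>g. g xs) gs)"
      using q that by (auto simp: list_all2_conv_all_nth)
  qed (use p in simp)
  then show ?thesis unfolding computable_def by blast
qed

text \<open>Composition with the projections \<open>m\<close>, ..., \<open>m + k - 1\<close>. It
  lets a function ignore leading arguments, such as the counter and the previous value in a
  recursion step.\<close>

lemma computable_drop:
  assumes "computable k f"
  shows "computable (m + k) (\<lambda>xs. f (drop m xs))"
proof -
  have "computable (m + k) (\<lambda>xs. f (map (\<lambda>g. g xs) (map (\<lambda>i xs. xs ! (m + i)) [0..<k])))"
    by (rule computable_comp) (use assms in \<open>auto intro: computable_nth\<close>)
  moreover have "map (\<lambda>g. g xs) (map (\<lambda>i xs. xs ! (m + i)) [0..<k]) = drop m xs"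
    if "length xs = m + k" for xs :: "nat list"
    using that by (intro nth_equalityI) auto
  ultimately show ?thesis by (metis (no_types, lifting) computable_cong)
qed

lemma computable_drop2: "computable k f \<Longrightarrow> computable (Suc (Suc k)) (\<lambda>xs. f (drop 2 xs))"
  using computable_drop[of k f 2] by simp

lemma computable_Suc:
  assumes "computable k f"
  shows "computable k (\<lambda>xs. Suc (f xs))"
proof -
  have "computes Succ xs (Suc (xs ! 0))" if "length xs = 1" for xs
    using that by (cases xs) (auto intro: computes.succ)
  then have "computable (length [f]) (\<lambda>xs. Suc (xs ! 0))"
    unfolding computable_def by auto
  from computable_comp[OF this, of k] assms show ?thesis by simp
qed

lemma computable_const: "computable k (\<lambda>xs. c)"
  by (induction c) (auto intro: computable_zero computable_Suc)

text \<open>\<open>PrimRec\<close> computes \<open>h\<close> from the counter and the parameters;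
  composing it with \<open>n\<close> and all projections inserts \<open>n xs\<close> as the counter.
  Any HOL function with these two recursion equations can serve as \<open>h\<close>.\<close>

lemma computable_rec:
  fixes h :: "nat \<Rightarrow> nat list \<Rightarrow> nat"
  assumes h0: "\<And>xs. h 0 xs = f xs" and hSuc: "\<And>i xs. h (Suc i) xs = g i (h i xs) xs"
    and n: "computable k n" and f: "computable k f"
    and g: "computable (Suc (Suc k)) (\<lambda>ys. g (ys ! 0) (ys ! 1) (drop 2 ys))"
  shows "computable k (\<lambda>xs. h (n xs) xs)"
proof -
  obtain p where p: "\<And>xs. length xs = k \<Longrightarrow> computes p xs (f xs)"
    using f unfolding computable_def by blast
  obtain q where
    "\<And>ys. length ys = Suc (Suc k) \<Longrightarrow> computes q ys (g (ys ! 0) (ys ! 1) (drop 2 ys))"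
    using g unfolding computable_def by blast
  from this[of "_ # _ # _"] have q: "computes q (i # y # xs) (g i y xs)" if "length xs = k" for i y xs
    using that by simp
  have "computes (PrimRec p q) (i # xs) (h i xs)" if "length xs = k" for i xs
    by (induction i) (auto simp: h0 hSuc intro: computes.intros p q that)
  then have "computes (PrimRec p q) xs (h (xs ! 0) (drop 1 xs))" if "length xs = Suc k" for xs
    using that by (cases xs) auto
  then have "computable (length (n # map (\<lambda>i xs. xs ! i) [0..<k])) (\<lambda>xs. h (xs ! 0) (drop 1 xs))"
    unfolding computable_def by auto
  then have "computable k (\<lambda>xs. (\<lambda>ys. h (ys ! 0) (drop 1 ys))
      (map (\<lambda>g. g xs) (n # map (\<lambda>i xs. xs ! i) [0..<k])))"
    by (rule computable_comp) (use n in \<open>auto intro: computable_nth\<close>)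
  then have "computable k (\<lambda>xs. h (n xs) (map (\<lambda>i. xs ! i) [0..<k]))"
    by (simp add: comp_def)
  then show ?thesis by (rule computable_cong) (metis map_nth)
qed

lemma computable_Least:
  assumes P: "decidable (Suc k) (\<lambda>ys. P (ys ! 0) (drop 1 ys))"
    and ex: "\<And>xs. length xs = k \<Longrightarrow> \<exists>n. P n xs"
  shows "computable k (\<lambda>xs. LEAST n. P n xs)"
proof -
  \<comment> \<open>\<open>Mini\<close> looks for the value 0, while \<open>of_bool\<close> is 1
    where the predicate holds, so the truth value is flipped first.\<close>
  let ?neg = "\<lambda>(b::nat). rec_nat 1 (\<lambda>_ _. 0) b :: nat"
  have "computable (Suc k) (\<lambda>ys. ?neg (of_bool (P (ys ! 0) (drop 1 ys))))"
    by (rule computable_rec[where h = "\<lambda>b ys. ?neg b" and f = "\<lambda>_. 1" and g = "\<lambda>_ _ _. 0"])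
      (auto intro: computable_const P[simplified])
  then obtain p where p':
    "\<And>ys. length ys = Suc k \<Longrightarrow> computes p ys (?neg (of_bool (P (ys ! 0) (drop 1 ys))))"
    unfolding computable_def by blast
  have p: "computes p (n # xs) (if P n xs then 0 else Suc 0)" if "length xs = k" for n xs
    using p'[of "n # xs"] that by (cases "P n xs") simp_all
  have "computes (Mini p) xs (LEAST n. P n xs)" if len: "length xs = k" for xs
  proof (rule computes.mini)
    show "computes p ((LEAST n. P n xs) # xs) 0"
      using p[OF len, of "LEAST n. P n xs"] LeastI_ex[OF ex[OF len]] by simp
    show "\<forall>i<LEAST n. P n xs. \<exists>y. computes p (i # xs) (Suc y)"
      using p[OF len] not_less_Least by metis
  qed
  then show ?thesis unfolding computable_def by blast
qed

section \<open>Arithmetic, truth values and finite products\<close>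

lemma computable_add:
  assumes "computable k f" "computable k g"
  shows "computable k (\<lambda>xs. f xs + g xs)"
  by (rule computable_rec[where h = "\<lambda>i xs. f xs + i" and f = f and g = "\<lambda>_ y _. Suc y"])
    (auto intro: assms computable_Suc computable_nth)

lemma computable_mult:
  assumes "computable k f" "computable k g"
  shows "computable k (\<lambda>xs. f xs * g xs)"
  by (rule computable_rec[where h = "\<lambda>i xs. f xs * i" and f = "\<lambda>_. 0" and g = "\<lambda>_ y xs. f xs + y"])
    (auto intro!: assms computable_const computable_add computable_nth computable_drop2)

lemma computable_power:
  assumes "computable k f" "computable k g"
  shows "computable k (\<lambda>xs. f xs ^ g xs)"
  by (rule computable_rec[where h = "\<lambda>i xs. f xs ^ i" and f = "\<lambda>_. 1" and g = "\<lambda>_ y xs. f xs * y"])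
    (auto intro!: assms computable_const computable_mult computable_nth computable_drop2)

lemma computable_pred:
  assumes "computable k f"
  shows "computable k (\<lambda>xs. f xs - 1)"
  by (rule computable_rec[where h = "\<lambda>i xs. i - 1" and f = "\<lambda>_. 0" and g = "\<lambda>i _ _. i"])
    (auto intro: assms computable_const computable_nth)

lemma computable_diff:
  assumes "computable k f" "computable k g"
  shows "computable k (\<lambda>xs. f xs - g xs)"
  by (rule computable_rec[where h = "\<lambda>i xs. f xs - i" and f = f and g = "\<lambda>_ y _. y - 1"])
    (auto intro: assms computable_pred[simplified] computable_nth)

text \<open>Subtraction is truncated: \<open>f xs - g xs\<close> is 0 exactly when the inequality
  holds, and \<open>1 - _\<close> turns this into a truth value.\<close>

lemma decidable_le:
  assumes "computable k f" "computable k g"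
  shows "decidable k (\<lambda>xs. f xs \<le> g xs)"
  by (rule computable_cong[where f = "\<lambda>xs. 1 - (f xs - g xs)"])
    (auto intro!: assms computable_diff computable_const)

lemma decidable_not:
  assumes "decidable k P"
  shows "decidable k (\<lambda>xs. \<not> P xs)"
  by (rule computable_cong[where f = "\<lambda>xs. 1 - of_bool (P xs)"])
    (auto intro!: assms computable_diff computable_const)

lemma decidable_conj:
  assumes "decidable k P" "decidable k Q"
  shows "decidable k (\<lambda>xs. P xs \<and> Q xs)"
  by (rule computable_cong[OF computable_mult[OF assms]]) auto

lemma decidable_disj:
  assumes "decidable k P" "decidable k Q"
  shows "decidable k (\<lambda>xs. P xs \<or> Q xs)"
  using decidable_not[OF decidable_conj[OF assms[THEN decidable_not]]] by simp

lemma decidable_eq: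
  assumes "computable k f" "computable k g"
  shows "decidable k (\<lambda>xs. f xs = g xs)"
  using decidable_conj[OF decidable_le[OF assms] decidable_le[OF assms(2,1)]]
  by (simp add: antisym_conv eq_iff)

lemma computable_if:
  assumes "decidable k P" "computable k f" "computable k g"
  shows "computable k (\<lambda>xs. if P xs then f xs else g xs)"
  by (rule computable_cong[where f = "\<lambda>xs. of_bool (P xs) * f xs + of_bool (\<not> P xs) * g xs"])
    (use assms in \<open>auto intro!: computable_add computable_mult decidable_not\<close>)

lemma computable_prod:
  fixes f :: "nat \<Rightarrow> nat list \<Rightarrow> nat"
  assumes "computable k n" "computable (Suc (Suc k)) (\<lambda>ys. f (ys ! 0) (drop 2 ys))"
  shows "computable k (\<lambda>xs. \<Prod>i<n xs. f i xs)"
  by (rule computable_rec[where h = "\<lambda>i xs. \<Prod>i<i. f i xs" and f = "\<lambda>_. 1" and g = "\<lambda>i y xs. y * f i xs"])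
    (auto intro!: assms computable_const computable_mult computable_nth)

section \<open>Decoding lists\<close>

lemma computable_triangle:
  assumes "computable k f"
  shows "computable k (\<lambda>xs. triangle (f xs))"
  by (rule computable_rec[where h = "\<lambda>i xs. triangle i" and f = "\<lambda>_. 0" and g = "\<lambda>i y _. y + Suc i"])
    (auto intro!: assms computable_const computable_add computable_Suc computable_nth)

lemma computable_prod_encode:
  assumes "computable k f" "computable k g"
  shows "computable k (\<lambda>xs. prod_encode (f xs, g xs))"
  unfolding prod_encode_def by (auto intro!: assms computable_add computable_triangle)

section \<open>Inverting the Cantor pairing function\<close>

lemma triangle_mono: "m \<le> n \<Longrightarrow> triangle m \<le> triangle n"
  unfolding triangle_def by (intro div_le_mono mult_le_mono) auto

text \<open>The diagonal of the pairing function that contains \<open>m\<close>, that is, the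
  \<open>t\<close> with \<open>triangle t \<le> m < triangle (Suc t)\<close>, in a form that
  minimisation computes.\<close>

definition triangle_root :: "nat \<Rightarrow> nat" where
  "triangle_root m = (LEAST t. Suc m \<le> triangle (Suc t))"

text \<open>The code is \<open>triangle (x + y) + x\<close> with \<open>x \<le> x + y\<close>, so it
  stays below \<open>triangle (Suc (x + y))\<close>, where the next diagonal starts.\<close>

lemma triangle_root_prod_encode: "triangle_root (prod_encode (x, y)) = x + y"
  unfolding triangle_root_def
proof (rule Least_equality)
  show "Suc (prod_encode (x, y)) \<le> triangle (Suc (x + y))"
    by (simp add: prod_encode_def)
next
  fix t assume t: "Suc (prod_encode (x, y)) \<le> triangle (Suc t)"
  show "x + y \<le> t"
  proof (rule ccontr)
    assume "\<not> x + y \<le> t"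
    then have "triangle (Suc t) \<le> triangle (x + y)" by (intro triangle_mono) simp
    with t show False by (simp add: prod_encode_def)
  qed
qed

lemma prod_decode_triangle_root:
  "fst (prod_decode m) = m - triangle (triangle_root m)"
  "snd (prod_decode m) = triangle_root m - (m - triangle (triangle_root m))"
proof -
  obtain x y where "m = prod_encode (x, y)" by (metis prod_decode_inverse surj_pair)
  then show "fst (prod_decode m) = m - triangle (triangle_root m)"
    "snd (prod_decode m) = triangle_root m - (m - triangle (triangle_root m))"
    by (simp_all add: triangle_root_prod_encode) (simp_all add: prod_encode_def)
qed

lemma computable_triangle_root:
  assumes "computable k f"
  shows "computable k (\<lambda>xs. triangle_root (f xs))"
  unfolding triangle_root_def
proof (rule computable_Least)
  show "decidable (Suc k) (\<lambda>ys. Suc (f (drop 1 ys)) \<le> triangle (Suc (ys ! 0)))"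
    using computable_drop[OF assms, of 1]
    by (auto intro!: decidable_le computable_add computable_Suc computable_triangle computable_nth)
  show "\<exists>t. Suc (f xs) \<le> triangle (Suc t)" for xs
    by (rule exI[of _ "f xs"]) simp
qed

lemma computable_fst_prod_decode:
  assumes "computable k f"
  shows "computable k (\<lambda>xs. fst (prod_decode (f xs)))"
  unfolding prod_decode_triangle_root
  by (intro computable_diff computable_triangle computable_triangle_root assms)

lemma computable_snd_prod_decode:
  assumes "computable k f"
  shows "computable k (\<lambda>xs. snd (prod_decode (f xs)))"
  unfolding prod_decode_triangle_root
  by (intro computable_diff computable_triangle computable_triangle_root assms)

section \<open>Products over coded lists\<close>

definition code_tl :: "nat \<Rightarrow> nat" where
  "code_tl c = (if c = 0 then 0 else snd (prod_decode (c - 1)))"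

lemma code_tl_list_encode: "code_tl (list_encode ns) = list_encode (tl ns)"
  by (cases ns) (auto simp: code_tl_def)

lemma code_tl_funpow_list_encode: "(code_tl ^^ i) (list_encode ns) = list_encode (drop i ns)"
  by (induction i) (auto simp: code_tl_list_encode drop_Suc tl_drop)

lemma computable_code_tl_funpow:
  assumes "computable k n" "computable k f"
  shows "computable k (\<lambda>xs. (code_tl ^^ n xs) (f xs))"
  by (rule computable_rec[where h = "\<lambda>i xs. (code_tl ^^ i) (f xs)" and f = f and g = "\<lambda>_ y _. code_tl y"])
    (auto simp: code_tl_def intro!: assms computable_if decidable_eq computable_const computable_nth
      computable_snd_prod_decode computable_pred[simplified])

text \<open>The upper limit \<open>c\<close> serves only as a bound for the length of the list with code \<open>c\<close>.\<close>

definition code_prod :: "nat \<Rightarrow> nat \<Rightarrow> nat \<Rightarrow> nat" where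
  "code_prod u v c =
    (\<Prod>i<c. if (code_tl ^^ i) c = 0 then 1 else u * fst (prod_decode ((code_tl ^^ i) c - 1)) + v)"

text \<open>Each \<open>Cons\<close> raises the code by at least one, since
  \<open>prod_encode (n, c) \<ge> c\<close>. Hence the product in \<open>code_prod\<close> reaches
  every entry.\<close>

lemma length_le_list_encode: "length ns \<le> list_encode ns"
proof (induction ns)
  case (Cons n ns)
  then show ?case using le_prod_encode_2[of "list_encode ns" n] by simp
qed simp

text \<open>Past the end of the list the code is 0 and the factor is 1. The induction peels off the
  factor at index 0 and allows every limit \<open>m \<ge> length ns\<close>, since the limit drops
  by one for the tail.\<close>

lemma code_prod_list_encode: "code_prod u v (list_encode ns) = prod_list (map (\<lambda>n. u * n + v) ns)"
proof -
  let ?t = "\<lambda>c. if c = 0 then 1 else u * fst (prod_decode (c - 1)) + v"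
  have "(\<Prod>i<m. ?t (list_encode (drop i ns))) = prod_list (map (\<lambda>n. u * n + v) ns)"
    if "length ns \<le> m" for m
    using that
  proof (induction ns arbitrary: m)
    case (Cons n ns)
    then obtain m' where m': "m = Suc m'" "length ns \<le> m'" by (cases m) auto
    have "(\<Prod>i<m. ?t (list_encode (drop i (n # ns))))
        = ?t (list_encode (n # ns)) * (\<Prod>i<m'. ?t (list_encode (drop i ns)))"
      unfolding m'(1) prod.lessThan_Suc_shift by (simp cong: if_cong)
    then show ?case unfolding Cons.IH[OF m'(2)] by simp
  qed simp
  from this[OF length_le_list_encode] show ?thesis
    by (simp only: code_prod_def code_tl_funpow_list_encode)
qed

lemma computable_code_prod:
  assumes "computable k f"
  shows "computable k (\<lambda>xs. code_prod u v (f xs))"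
  unfolding code_prod_def
  by (intro computable_prod computable_if decidable_eq computable_const computable_add computable_mult
      computable_fst_prod_decode computable_pred computable_code_tl_funpow computable_nth
      computable_drop2 assms) auto

section \<open>Bounds for the representations of a rational\<close>

text \<open>This is \<open>(1 + 1/d) ^ k \<le> 1 + (2 ^ k - 1) / d\<close>, cleared of fractions and
  subtraction. It turns a lower bound for \<open>(1 + 1/d) ^ k\<close> into an upper bound for
  \<open>d\<close>.\<close>

lemma power_Suc_base_bound:
  fixes d :: nat
  assumes "d \<ge> 1"
  shows "(d + 1) ^ k * d + d ^ k \<le> d ^ k * (d + 2 ^ k)"
proof (induction k)
  case (Suc k)
  obtain e where e: "d = Suc e" using assms by (cases d) auto
  obtain w where w: "(2::nat) ^ k = Suc w" by (metis not0_implies_Suc power_not_zero zero_neq_numeral)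
  have "(d + 1) ^ k * d \<le> d ^ k * (d + w)" using Suc.IH by (simp add: w algebra_simps)
  then have "(d + 1) * ((d + 1) ^ k * d) \<le> (d + 1) * (d ^ k * (d + w))" by (rule mult_le_mono2)
  also have "\<dots> = d ^ k * ((d + 1) * (d + w))" by (simp only: mult_ac)
  \<comment> \<open>With \<open>w = 2 ^ k - 1\<close> this comes down to
    \<open>w \<le> d * w\<close>, which holds as \<open>d \<ge> 1\<close>.\<close>
  also have "\<dots> \<le> d ^ k * (d * (d + 2 * w + 1))"
    by (rule mult_le_mono2) (simp add: e algebra_simps)
  finally have "(d + 1) * ((d + 1) ^ k * d) + d ^ Suc k \<le> d ^ k * (d * (d + 2 * w + 1)) + d ^ Suc k"
    by simp
  also have "\<dots> = d ^ Suc k * (d + 2 ^ Suc k)" by (simp add: w algebra_simps)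
  finally show ?case by (simp only: power_Suc mult.assoc)
qed simp

section \<open>Size estimates for products of generators\<close>

abbreviation num_prod :: "nat list \<Rightarrow> nat" where
  "num_prod ns \<equiv> prod_list (map (\<lambda>n. 3 * n + 2) ns)"

abbreviation den_prod :: "nat list \<Rightarrow> nat" where
  "den_prod ns \<equiv> prod_list (map (\<lambda>n. 2 * n + 1) ns)"

lemma den_prod_pos: "den_prod ns > 0"
  by (induction ns) auto

text \<open>Every generator exceeds 3/2, because
  \<open>2 * (3 * n + 2) = 3 * (2 * n + 1) + 1\<close>; these inequalities are multiplied over the
  list.\<close>

lemma num_prod_gt: "ns \<noteq> [] \<Longrightarrow> 3 ^ length ns * den_prod ns < 2 ^ length ns * num_prod ns"
proof (induction ns rule: list_nonempty_induct)
  case (cons n ns)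
  have "3 ^ length (n # ns) * den_prod (n # ns) = (6 * n + 3) * (3 ^ length ns * den_prod ns)"
    by (simp add: algebra_simps)
  also have "\<dots> < (6 * n + 4) * (2 ^ length ns * num_prod ns)"
    by (rule mult_strict_mono) (use cons.IH in auto)
  also have "\<dots> = 2 ^ length (n # ns) * num_prod (n # ns)"
    by (simp add: algebra_simps)
  finally show ?case .
qed simp

text \<open>The generators decrease: in the cross-multiplied comparison of \<open>g(m)\<close> and
  \<open>g(n)\<close> the two sides differ by \<open>m - n\<close>. So the product is at most the
  power of \<open>g(n)\<close>.\<close>

lemma num_prod_le:
  assumes "\<And>m. m \<in> set ns \<Longrightarrow> n \<le> m"
  shows "(2 * n + 1) ^ length ns * num_prod ns \<le> (3 * n + 2) ^ length ns * den_prod ns"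
  using assms
proof (induction ns)
  case (Cons m ns)
  have le: "(2 * n + 1) * (3 * m + 2) \<le> (3 * n + 2) * (2 * m + 1)"
    using Cons.prems[of m] by (simp add: algebra_simps)
  have "((2 * n + 1) * (3 * m + 2)) * ((2 * n + 1) ^ length ns * num_prod ns)
      \<le> ((3 * n + 2) * (2 * m + 1)) * ((3 * n + 2) ^ length ns * den_prod ns)"
    by (rule mult_le_mono[OF le Cons.IH]) (use Cons.prems in auto)
  then show ?case by (simp only: list.map list.size prod_list.Cons power_Suc power_add mult_ac) (simp add: mult_ac)
qed simp

text \<open>A product of \<open>k \<ge> 1\<close> generators exceeds
  \<open>(3/2) ^ k \<ge> k / 2\<close>, whence \<open>k \<le> 2 * a / b \<le> 2 * a\<close>.\<close>

lemma length_bound: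
  assumes "a * den_prod ns = b * num_prod ns" "b > 0"
  shows "length ns \<le> 2 * a"
proof (cases "ns = []")
  case False
  let ?k = "length ns"
  have "k * 2 ^ k \<le> 2 * 3 ^ k" for k :: nat
  proof (induction k)
    case (Suc k)
    have "(2::nat) ^ k \<le> 3 ^ k" by (rule power_mono) auto
    with Suc show ?case by simp
  qed simp
  then have "?k * 2 ^ ?k * den_prod ns \<le> 2 * 3 ^ ?k * den_prod ns"
    by (rule mult_le_mono1)
  also have "\<dots> \<le> 2 * (2 ^ ?k * num_prod ns)"
    using num_prod_gt[OF False] by simp
  also have "\<dots> \<le> 2 * (2 ^ ?k * (b * num_prod ns))"
    using assms(2) by simp
  also have "\<dots> = 2 * a * 2 ^ ?k * den_prod ns" unfolding assms(1)[symmetric] by (simp only: mult_ac)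
  finally show ?thesis using den_prod_pos[of ns] by simp
qed simp

text \<open>With \<open>k\<close> factors, integrality gives
  \<open>a / b \<ge> (3/2) ^ k * (1 + 1 / (b * 3 ^ k))\<close>, while minimality of \<open>n\<close>
  gives \<open>a / b \<le> (3/2) ^ k * (1 + 1/d) ^ k\<close>. By \<open>power_Suc_base_bound\<close>
  this forces \<open>d \<le> b * 3 ^ k * 2 ^ k\<close>.\<close>

lemma least_index_bound:
  assumes eq: "a * den_prod ns = b * num_prod ns"
    and ns: "ns \<noteq> []" and n: "\<And>m. m \<in> set ns \<Longrightarrow> n \<le> m"
    and b: "b > 0"
  shows "n \<le> 6 ^ length ns * b"
proof -
  let ?k = "length ns"
  \<comment> \<open>Since \<open>d = 3 * (2 * n + 1)\<close> and
    \<open>d + 1 = 2 * (3 * n + 2)\<close>, the generator is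
    \<open>g(n) = 3/2 * (1 + 1/d)\<close>.\<close>
  define d where "d = 6 * n + 3"
  have "b * 3 ^ ?k * den_prod ns < b * (2 ^ ?k * num_prod ns)"
    using num_prod_gt[OF ns] b by (simp add: mult.assoc)
  also have "\<dots> = a * 2 ^ ?k * den_prod ns" using eq by (simp add: mult_ac)
  finally have gap: "b * 3 ^ ?k + 1 \<le> a * 2 ^ ?k" by simp
  have "a * (2 * n + 1) ^ ?k * den_prod ns = b * ((2 * n + 1) ^ ?k * num_prod ns)"
    using eq by (simp add: mult_ac)
  also have "\<dots> \<le> b * ((3 * n + 2) ^ ?k * den_prod ns)"
    using num_prod_le[OF n] by (rule mult_le_mono2)
  finally have le: "a * (2 * n + 1) ^ ?k \<le> b * (3 * n + 2) ^ ?k"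
    using den_prod_pos[of ns] by (simp add: mult.assoc[symmetric])
  have six: "(6::nat) ^ ?k = 2 ^ ?k * 3 ^ ?k" by (simp flip: power_mult_distrib)
  have d3: "d ^ ?k = 3 ^ ?k * (2 * n + 1) ^ ?k"
    unfolding d_def power_mult_distrib[symmetric] by (simp add: algebra_simps)
  have d1: "(d + 1) ^ ?k = 2 ^ ?k * (3 * n + 2) ^ ?k"
    unfolding d_def power_mult_distrib[symmetric] by (rule arg_cong[where f = "\<lambda>x. x ^ ?k"]) simp
  have "(b * 3 ^ ?k + 1) * d ^ ?k \<le> a * 2 ^ ?k * d ^ ?k"
    using gap by (rule mult_le_mono1)
  also have "\<dots> = 6 ^ ?k * (a * (2 * n + 1) ^ ?k)"
    by (simp only: d3 six mult_ac)
  also have "\<dots> \<le> 6 ^ ?k * (b * (3 * n + 2) ^ ?k)"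
    using le by (rule mult_le_mono2)
  also have "\<dots> = b * 3 ^ ?k * (d + 1) ^ ?k"
    by (simp only: d1 six mult_ac)
  finally have "(b * 3 ^ ?k + 1) * d ^ ?k * d \<le> b * 3 ^ ?k * ((d + 1) ^ ?k * d)"
    by (simp add: mult.assoc[symmetric])
  also have "\<dots> \<le> b * 3 ^ ?k * (d ^ ?k * (d + 2 ^ ?k))"
    using power_Suc_base_bound[of d ?k] by (intro mult_le_mono2) (simp add: d_def)
  finally have "d ^ ?k * d \<le> d ^ ?k * (b * 3 ^ ?k * 2 ^ ?k)"
    by (simp add: algebra_simps)
  then have "d \<le> b * 3 ^ ?k * 2 ^ ?k" by (simp add: d_def)
  also have "\<dots> = 6 ^ ?k * b" by (simp only: six mult_ac)
  finally show ?thesis by (simp add: d_def)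
qed

text \<open>If \<open>B\<close> bounds the denominator and the least index \<open>n\<close> is at most \<open>6 ^ K * B\<close>, then
  \<open>den_step K B\<close> bounds the denominator after division by \<open>g(n)\<close>.\<close>

definition den_step :: "nat \<Rightarrow> nat \<Rightarrow> nat" where
  "den_step K B = B * (3 * (6 ^ K * B) + 2)"

lemma le_den_step_funpow: "B \<le> (den_step K ^^ k) B"
proof (induction k)
  case (Suc k)
  moreover have "C \<le> den_step K C" for C by (simp add: den_step_def)
  ultimately show ?case by (simp add: order_trans)
qed simp

lemma den_step_funpow_mono: "B \<le> C \<Longrightarrow> (den_step K ^^ k) B \<le> (den_step K ^^ k) C"
proof (rule funpow_mono)
  show "mono (den_step K)"
    unfolding den_step_def by (intro monoI mult_le_mono add_le_mono) simp_all
qed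

text \<open>The head \<open>m\<close> of a sorted list is its least index, so
  \<open>least_index_bound\<close> applies. Moving its factor across the equation leaves the tail
  with denominator \<open>b * (3 * m + 2) \<le> den_step K b\<close>. Fixing \<open>K\<close> makes
  the step the same at every level.\<close>

lemma index_bound:
  assumes "a * den_prod ns = b * num_prod ns" "b > 0" "sorted ns" "length ns \<le> K" "n \<in> set ns"
  shows "n \<le> 6 ^ K * (den_step K ^^ length ns) b"
  using assms
proof (induction ns arbitrary: a b)
  case (Cons m ns)
  have "m \<le> 6 ^ length (m # ns) * b"
    using Cons.prems by (intro least_index_bound[of a]) auto
  also have "\<dots> \<le> 6 ^ K * b"
    using Cons.prems by (intro mult_le_mono1 power_increasing) auto
  finally have m: "m \<le> 6 ^ K * b" .
  show ?case
  proof (cases "n = m")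
    case True
    then show ?thesis
      using m le_den_step_funpow[of b "length (m # ns)" K] by (meson mult_le_mono2 order_trans)
  next
    case False
    have "n \<le> 6 ^ K * (den_step K ^^ length ns) (b * (3 * m + 2))"
    proof (rule Cons.IH)
      show "a * (2 * m + 1) * den_prod ns = b * (3 * m + 2) * num_prod ns"
        using Cons.prems(1) by (simp only: list.map prod_list.Cons mult.assoc)
    qed (use Cons.prems False in auto)
    also have "\<dots> \<le> 6 ^ K * (den_step K ^^ length ns) (den_step K b)"
      unfolding den_step_def[of K b] using m
      by (intro mult_le_mono2 den_step_funpow_mono) auto
    finally show ?thesis by (simp add: funpow_swap1)
  qed
qed simp

text \<open>This is \<open>list_encode (replicate k N)\<close>, written as an iteration to fit
  primitive recursion.\<close>

definition code_bound :: "nat \<Rightarrow> nat \<Rightarrow> nat" where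
  "code_bound N k = ((\<lambda>c. Suc (prod_encode (N, c))) ^^ k) 0"

lemma prod_encode_mono: "x \<le> x' \<Longrightarrow> y \<le> y' \<Longrightarrow> prod_encode (x, y) \<le> prod_encode (x', y')"
  unfolding prod_encode_def by (simp add: add_mono triangle_mono)

lemma list_encode_le_code_bound:
  assumes "\<And>n. n \<in> set ns \<Longrightarrow> n \<le> N" "length ns \<le> k"
  shows "list_encode ns \<le> code_bound N k"
  using assms
proof (induction ns arbitrary: k)
  case (Cons n ns)
  then obtain k' where "k = Suc k'" "length ns \<le> k'" by (cases k) auto
  with Cons show ?case by (simp add: code_bound_def prod_encode_mono)
qed simp

text \<open>By \<open>length_bound\<close>, \<open>2 * a\<close> bounds the number of factors. It is
  therefore used as \<open>K\<close>, as the number of denominator steps and as the length of the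
  coded list.\<close>

definition solution_bound :: "nat \<Rightarrow> nat \<Rightarrow> nat" where
  "solution_bound a b = code_bound (6 ^ (2 * a) * (den_step (2 * a) ^^ (2 * a)) b) (2 * a)"

lemma sorted_solution_bound:
  assumes "a * den_prod ns = b * num_prod ns" "b > 0" "sorted ns"
  shows "list_encode ns \<le> solution_bound a b"
  unfolding solution_bound_def
proof (rule list_encode_le_code_bound)
  show len: "length ns \<le> 2 * a" using assms by (intro length_bound)
  fix n assume "n \<in> set ns"
  with assms len have "n \<le> 6 ^ (2 * a) * (den_step (2 * a) ^^ length ns) b"
    by (intro index_bound) auto
  \<comment> \<open>Padding the iteration to \<open>2 * a\<close> steps only enlarges the value and
    removes the dependence on \<open>ns\<close>.\<close>
  also have "(den_step (2 * a) ^^ length ns) b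
      \<le> (den_step (2 * a) ^^ (2 * a - length ns)) ((den_step (2 * a) ^^ length ns) b)"
    by (rule le_den_step_funpow)
  also have "\<dots> = (den_step (2 * a) ^^ (2 * a)) b"
    using len by (simp flip: funpow_add[THEN fun_cong, unfolded comp_def])
  finally show "n \<le> 6 ^ (2 * a) * (den_step (2 * a) ^^ (2 * a)) b" by simp
qed

lemma computable_solution_bound:
  assumes a: "computable k a" and b: "computable k b"
  shows "computable k (\<lambda>xs. solution_bound (a xs) (b xs))"
proof -
  have den: "computable k (\<lambda>xs. (den_step (2 * a xs) ^^ (2 * a xs)) (b xs))"
    by (rule computable_rec[where h = "\<lambda>i xs. (den_step (2 * a xs) ^^ i) (b xs)" and f = b
          and g = "\<lambda>_ y xs. den_step (2 * a xs) y"])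
      (auto simp: den_step_def intro!: computable_add computable_mult computable_power
        computable_const computable_nth computable_drop2 a b)
  let ?N = "\<lambda>xs. 6 ^ (2 * a xs) * (den_step (2 * a xs) ^^ (2 * a xs)) (b xs)"
  have N: "computable k ?N"
    by (intro computable_mult computable_power computable_const a den)
  show ?thesis
    unfolding solution_bound_def
    by (rule computable_rec[where h = "\<lambda>i xs. code_bound (?N xs) i" and f = "\<lambda>_. 0"
          and g = "\<lambda>_ y xs. Suc (prod_encode (?N xs, y))"])
      (auto simp: code_bound_def intro!: computable_Suc computable_prod_encode computable_mult
        computable_const computable_nth computable_drop2[OF N] a)
qed

section \<open>The decision procedure\<close>

text \<open>The representation of \<open>a / b\<close>, cross-multiplied. Code 0 is the empty list,
  which is excluded because a product must have at least one factor.\<close>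

definition is_solution :: "nat \<Rightarrow> nat \<Rightarrow> nat \<Rightarrow> bool" where
  "is_solution a b c \<longleftrightarrow> \<not> c = 0 \<and> a * code_prod 2 1 c = b * code_prod 3 2 c"

lemma is_solution_list_encode:
  "is_solution a b (list_encode ns) \<longleftrightarrow> ns \<noteq> [] \<and> a * den_prod ns = b * num_prod ns"
  using list_encode_eq[of ns "[]"] by (simp add: is_solution_def code_prod_list_encode)

lemma decidable_is_solution:
  assumes "computable k a" "computable k b" "computable k c"
  shows "decidable k (\<lambda>xs. is_solution (a xs) (b xs) (c xs))"
  unfolding is_solution_def
  by (intro decidable_conj decidable_not decidable_eq computable_mult computable_code_prod
      computable_const assms)

text \<open>The second alternative makes the minimisation halt on every input; the value found is
  tested again afterwards to see which alternative stopped it.\<close>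

definition search :: "nat \<Rightarrow> nat \<Rightarrow> nat" where
  "search a b = (LEAST c. is_solution a b c \<or> solution_bound a b \<le> c)"

lemma computable_search: "computable 2 (\<lambda>xs. search (xs ! 0) (xs ! 1))"
  unfolding search_def
proof (rule computable_Least)
  have "decidable (Suc 2) (\<lambda>ys. is_solution (ys ! 1) (ys ! 2) (ys ! 0)
      \<or> solution_bound (ys ! 1) (ys ! 2) \<le> ys ! 0)"
    by (intro decidable_disj decidable_is_solution decidable_le computable_solution_bound
        computable_nth) auto
  then show "decidable (Suc 2) (\<lambda>ys. is_solution (drop 1 ys ! 0) (drop 1 ys ! 1) (ys ! 0)
      \<or> solution_bound (drop 1 ys ! 0) (drop 1 ys ! 1) \<le> ys ! 0)"
    by (rule computable_cong) (simp add: numeral_2_eq_2)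
  show "\<exists>c. is_solution (xs ! 0) (xs ! 1) c \<or> solution_bound (xs ! 0) (xs ! 1) \<le> c" for xs
    by blast
qed

text \<open>Products commute, so a solution may be sorted, and its code \<open>c\<close> is then
  below the bound. A search stopped by the bound gives
  \<open>c \<le> solution_bound a b \<le> search a b \<le> c\<close>, so it has stopped at the
  solution \<open>c\<close> itself.\<close>

lemma is_solution_search:
  assumes "is_solution a b (list_encode ns)" "b > 0"
  shows "is_solution a b (search a b)"
proof -
  have prod: "prod_list (map f (sort ns)) = prod_list (map f ns)" for f :: "nat \<Rightarrow> nat"
    by (simp flip: prod_mset_prod_list)
  have "sort ns \<noteq> [] \<longleftrightarrow> ns \<noteq> []" by (metis set_empty set_sort)
  then have sol: "is_solution a b (list_encode (sort ns))"
    using assms(1) unfolding is_solution_list_encode prod by blast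
  then have "list_encode (sort ns) \<le> solution_bound a b"
    using assms(2) by (intro sorted_solution_bound) (auto simp: is_solution_list_encode)
  moreover have "search a b \<le> list_encode (sort ns)"
    unfolding search_def using sol by (intro Least_le) simp
  moreover have "is_solution a b (search a b) \<or> solution_bound a b \<le> search a b"
    unfolding search_def by (rule LeastI_ex) blast
  ultimately show ?thesis using sol by (metis order_antisym order_trans)
qed

lemma prod_list_wooley_gen: "prod_list (map wooley_gen ns) = of_nat (num_prod ns) / of_nat (den_prod ns)"
  by (induction ns) (simp_all add: wooley_gen_def algebra_simps)

lemma is_solution_iff_prod_list:
  assumes "b > 0"
  shows "is_solution a b (list_encode ns) \<longleftrightarrow>
    ns \<noteq> [] \<and> of_nat a / of_nat b = prod_list (map wooley_gen ns)"
proof -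
  have "(of_nat a / of_nat b = prod_list (map wooley_gen ns)) \<longleftrightarrow>
      (of_nat (a * den_prod ns) :: rat) = of_nat (b * num_prod ns)"
    using assms den_prod_pos[of ns] unfolding prod_list_wooley_gen of_nat_mult
    by (subst frac_eq_eq) (auto simp: mult.commute)
  then show ?thesis by (simp only: of_nat_eq_iff is_solution_list_encode)
qed

theorem theorem2p1:
  "\<exists>p. \<forall>r::rat. r > 0 \<longrightarrow>
    (if r \<in> wooley_semigroup
     then \<exists>ns. ns \<noteq> [] \<and> r = prod_list (map wooley_gen ns) \<and>
            computes p (rat_input r) (answer_encode (Some ns))
     else computes p (rat_input r) (answer_encode None))"
proof -
  \<comment> \<open>The two values match \<open>answer_encode\<close>: a successor for a found list
    code, 0 for \<open>None\<close>.\<close>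
  let ?F = "\<lambda>a b. if is_solution a b (search a b) then Suc (search a b) else 0"
  have "computable 2 (\<lambda>xs. ?F (xs ! 0) (xs ! 1))"
    by (intro computable_if decidable_is_solution computable_Suc computable_search computable_const
        computable_nth) auto
  then obtain p where p': "\<And>xs. length xs = 2 \<Longrightarrow> computes p xs (?F (xs ! 0) (xs ! 1))"
    unfolding computable_def by blast
  have p: "computes p [a, b] (?F a b)" for a b
    using p'[of "[a, b]"] by (simp cong: if_cong)
  show ?thesis
  proof (intro exI[of _ p] allI impI)
    fix r :: rat assume "r > 0"
    obtain i j where ij: "quotient_of r = (i, j)" by fastforce
    define a b where "a = nat i" and "b = nat j"
    have "j > 0" using quotient_of_denom_pos[OF ij] .
    moreover have r_ij: "r = of_int i / of_int j" using quotient_of_div[OF ij] .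
    ultimately have "i > 0" using \<open>r > 0\<close> by (simp add: zero_less_divide_iff)
    have b: "b > 0" and r: "r = of_nat a / of_nat b"
      using \<open>i > 0\<close> \<open>j > 0\<close> r_ij by (simp_all add: a_def b_def)
    have input: "rat_input r = [a, b]" by (simp add: rat_input_def ij a_def b_def)
    show "if r \<in> wooley_semigroup
       then \<exists>ns. ns \<noteq> [] \<and> r = prod_list (map wooley_gen ns) \<and>
              computes p (rat_input r) (answer_encode (Some ns))
       else computes p (rat_input r) (answer_encode None)"
    proof (cases "is_solution a b (search a b)")
      case True
      \<comment> \<open>Every natural number codes a list, so the value found yields explicit
        indices.\<close>
      obtain ns where ns: "search a b = list_encode ns" by (metis list_decode_inverse)
      with True have "ns \<noteq> []" "r = prod_list (map wooley_gen ns)"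
        using is_solution_iff_prod_list[OF b] r by auto
      moreover from this have "r \<in> wooley_semigroup"
        unfolding wooley_semigroup_eq_products by blast
      moreover have "computes p (rat_input r) (answer_encode (Some ns))"
        using p[of a b] True ns input by simp
      ultimately show ?thesis by auto
    next
      case False
      then have "\<not> is_solution a b (list_encode ns)" for ns
        using is_solution_search b by blast
      then have "r \<notin> wooley_semigroup"
        unfolding wooley_semigroup_eq_products is_solution_iff_prod_list[OF b] r by auto
      then show ?thesis using p[of a b] False input by simp
    qed
  qed
qed

end
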